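(* For every $n\ge 2$ and every real $q>0$, the polynomial $$D_n(x;q)=\sum_{\sigma\in D_n}q^{\operatorname{neg}_D\sigma}x^{\operatorname{des}_D\sigma}$$ in $x$ has only real zeros.
   Context: A signed permutation of $[n]$ is a bijection $\sigma$ of $\{\pm1,\dots,\pm n\}$ with $\sigma(-i)=-\sigma(i)$, written in one-line notation $(\sigma_1,\dots,\sigma_n)$, $\sigma_i=\sigma(i)$. $D_n$ denotes the set of even signed permutations of $[n]$, i.e. those with an even number of negative entries among $\sigma_1,\dots,\sigma_n$ (the Coxeter group of type $D_n$). $\operatorname{neg}_D\sigma$ is the number of negative entries among $\sigma_2,\dots,\sigma_n$. $\operatorname{Des}_D\sigma=\{0:\text{if }\sigma_1+\sigma_2<0\}\cup\{i\in[n-1]:\sigma_i>\sigma_{i+1}\}$ and $\operatorname{des}_D\sigma=|\operatorname{Des}_D\sigma|$. *)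

theory Defs
  imports Complex_Main
    "HOL-Combinatorics.Permutations"
    "HOL-Computational_Algebra.Polynomial"
begin

text \<open>
  Signed permutations of \<open>[n]\<close> are represented as odd functions on all integers that are the
  identity outside \<open>{\<plusminus>1, \<dots>, \<plusminus>n}\<close>; this makes the representation of each bijection of
  \<open>{\<plusminus>1, \<dots>, \<plusminus>n}\<close> unique, so that sums over the group count every element once.
\<close>

definition signed_perms :: "nat \<Rightarrow> (int \<Rightarrow> int) set" where
  "signed_perms n =
     {\<sigma>. \<sigma> permutes ({- int n..int n} - {0}) \<and>
         (\<forall>i \<in> {- int n..int n} - {0}. \<sigma> (- i) = - \<sigma> i)}"

definition even_signed_perms :: "nat \<Rightarrow> (int \<Rightarrow> int) set" where
  "even_signed_perms n =
     {\<sigma> \<in> signed_perms n. even (card {i \<in> {1..int n}. \<sigma> i < 0})}"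

definition neg_D :: "nat \<Rightarrow> (int \<Rightarrow> int) \<Rightarrow> nat" where
  "neg_D n \<sigma> = card {i \<in> {2..int n}. \<sigma> i < 0}"

definition Des_D :: "nat \<Rightarrow> (int \<Rightarrow> int) \<Rightarrow> int set" where
  "Des_D n \<sigma> =
     (if \<sigma> 1 + \<sigma> 2 < 0 then {0} else {}) \<union> {i \<in> {1..int n - 1}. \<sigma> i > \<sigma> (i + 1)}"

definition des_D :: "nat \<Rightarrow> (int \<Rightarrow> int) \<Rightarrow> nat" where
  "des_D n \<sigma> = card (Des_D n \<sigma>)"

definition D_poly :: "nat \<Rightarrow> real \<Rightarrow> real poly" where
  "D_poly n q = (\<Sum>\<sigma> \<in> even_signed_perms n. monom (q ^ neg_D n \<sigma>) (des_D n \<sigma>))"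

definition only_real_zeros :: "real poly \<Rightarrow> bool" where
  "only_real_zeros p \<longleftrightarrow> (\<forall>z::complex. poly (map_poly complex_of_real p) z = 0 \<longrightarrow> z \<in> \<real>)"

end

theory Submission
  imports Defs
begin

text \<open>
  Changing the sign of \<open>\<sigma> 1\<close> preserves both statistics, so \<open>2 * D_n(x; q)\<close> is the sum over all
  signed permutations. Split that sum according to the last entry \<open>k\<close>. Deleting the last entry
  gives a recurrence in which the \<open>k\<close>-th summand at level \<open>n + 1\<close> is, up to a power of \<open>q\<close>, the
  sum of the summands at level \<open>n\<close> with the factor \<open>x\<close> inserted from a threshold on. Such
  recurrences preserve interlacing families, and at a fixed point \<open>z\<close> of the upper half plane
  interlacing is just the positivity of the bilinear form \<open>Im (b * cnj a)\<close>.

  The extreme summands at level \<open>n + 1\<close> are \<open>S\<close> and \<open>q * z * S\<close> with \<open>S\<close> the full sum at level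
  \<open>n\<close>. If \<open>S \<noteq> 0\<close> the form is strictly positive on this pair, whence the next full sum does not
  vanish at \<open>z\<close> either.

  The family is interlacing from \<open>n = 4\<close> on. There every member except the extreme ones is \<open>z\<close>
  times a quadratic, and interlacing of quadratics is a discriminant inequality in \<open>q\<close>.
\<close>

section \<open>Pointwise interlacing\<close>

text \<open>Up to a positive factor this is the imaginary part of \<open>b / a\<close>. For real polynomials
  \<open>f\<close> and \<open>g\<close> with nonnegative coefficients, \<open>cross (f z) (g z) \<ge> 0\<close> on the upper half plane expresses
  that \<open>f\<close> interlaces \<open>g\<close>, in a form that is bilinear and can be used at one fixed \<open>z\<close>.\<close>

definition cross :: "complex \<Rightarrow> complex \<Rightarrow> real" where
  "cross a b = Im (b * cnj a)"

lemma cross_self [simp]: "cross a a = 0"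
  by (simp add: cross_def)

lemma cross_add_left: "cross (a + b) c = cross a c + cross b c"
  and cross_add_right: "cross c (a + b) = cross c a + cross c b"
  by (simp_all add: cross_def algebra_simps)

lemma cross_zero_left [simp]: "cross 0 a = 0"
  and cross_zero_right [simp]: "cross a 0 = 0"
  by (simp_all add: cross_def)

lemma cross_scale_left: "cross (of_real r * a) b = r * cross a b"
  and cross_scale_right: "cross a (of_real r * b) = r * cross a b"
  by (simp_all add: cross_def algebra_simps)

lemma cross_mult_both: "cross (z * a) (z * b) = (cmod z)\<^sup>2 * cross a b"
  by (simp add: cross_def cmod_power2) (simp add: power2_eq_square algebra_simps)

lemma cross_mult_self: "cross a (z * a) = Im z * (cmod a)\<^sup>2"
  by (simp add: cross_def cmod_power2) (simp add: power2_eq_square algebra_simps)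

lemma cross_sum_nonneg:
  assumes "\<And>i j. i \<in> A \<Longrightarrow> j \<in> B \<Longrightarrow> cross (f i) (g j) \<ge> 0"
  shows "cross (sum f A) (sum g B) \<ge> 0"
proof -
  have "cross (sum f A) (sum g B) = (\<Sum>j\<in>B. \<Sum>i\<in>A. cross (f i) (g j))"
    by (simp add: cross_def sum_product)
  then show ?thesis
    using assms by (simp add: sum_nonneg)
qed

text \<open>Bilinearity expands both forms into nonnegative terms. The mixed terms in
  \<open>a\<close> and \<open>c\<close> cancel in the first expansion and complete the square
  \<open>cmod (z * a + c)\<close> in the second.\<close>

lemma cross_step:
  assumes "Im z \<ge> 0" "cross a b \<ge> 0" "cross b c \<ge> 0" "cross b (z * a) \<ge> 0" "cross c (z * b) \<ge> 0"
  shows "cross (z * a + b + c) (z * a + z * b + c) \<ge> 0"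
    and "cross (z * a + z * b + c) (z * (z * a + b + c)) \<ge> 0"
proof -
  have "cross (z * a + b + c) (z * a + z * b + c)
      = (cmod z)\<^sup>2 * cross a b + cross c (z * b) + cross b (z * a) + cross b c + Im z * (cmod b)\<^sup>2"
    by (simp add: cross_def cmod_power2) (simp add: power2_eq_square algebra_simps)
  then show "cross (z * a + b + c) (z * a + z * b + c) \<ge> 0"
    using assms by simp
  have "cross (z * a + z * b + c) (z * (z * a + b + c))
      = Im z * (cmod (z * a + c))\<^sup>2 + (cmod z)\<^sup>2 * cross a b + cross c (z * b)
        + (cmod z)\<^sup>2 * (cross b (z * a) + cross b c)"
    by (simp add: cross_def cmod_power2) (simp add: power2_eq_square algebra_simps)
  then show "cross (z * a + z * b + c) (z * (z * a + b + c)) \<ge> 0"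
    using assms by simp
qed

section \<open>Coordinates in a sector of the plane\<close>

text \<open>Cramer's rule in the real basis \<open>s\<close>, \<open>z * s\<close>:
  \<open>cross\<close> is the determinant of two plane vectors, and that of the basis is Im z times
  |s|^2.\<close>

lemma cross_sector:
  assumes "Im z > 0" "s \<noteq> 0"
  shows "a = (of_real (cross a (z * s) / ((cmod s)\<^sup>2 * Im z))
            + of_real (cross s a / ((cmod s)\<^sup>2 * Im z)) * z) * s"
proof -
  have *: "of_real ((cmod s)\<^sup>2 * Im z) * a = (of_real (cross a (z * s)) + of_real (cross s a) * z) * s"
    by (simp add: cross_def cmod_power2 complex_eq_iff) (simp add: power2_eq_square algebra_simps)
  have "(cmod s)\<^sup>2 * Im z \<noteq> 0"
    using assms by simp
  then show ?thesis
    using * by (simp add: field_simps)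
qed

lemma cross_sector_eq:
  "cross ((of_real a + of_real b * z) * s) ((of_real c + of_real d * z) * s)
     = (cmod s)\<^sup>2 * Im z * (a * d - c * b)"
  "cross ((of_real c + of_real d * z) * s) (z * ((of_real a + of_real b * z) * s))
     = (cmod s)\<^sup>2 * Im z * (a * c + 2 * Re z * (c * b) + (cmod z)\<^sup>2 * (b * d))"
  by (simp add: cross_def cmod_power2; simp add: power2_eq_square algebra_simps)+

lemma cross_sector_nonneg:
  assumes "Im z > 0" "c > 0" "b \<ge> 0" "d \<ge> 0" "a \<ge> 0" "a * d \<ge> c * b"
  shows "cross ((of_real a + of_real b * z) * s) ((of_real c + of_real d * z) * s) \<ge> 0"
    and "cross ((of_real c + of_real d * z) * s) (z * ((of_real a + of_real b * z) * s)) \<ge> 0"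
proof -
  show "cross ((of_real a + of_real b * z) * s) ((of_real c + of_real d * z) * s) \<ge> 0"
    using assms by (simp add: cross_sector_eq)
  have "a * c + 2 * Re z * (c * b) + (cmod z)\<^sup>2 * (b * d) \<ge> 0"
  proof (cases "d = 0")
    case True
    then have "c * b = 0"
      using assms by (metis mult_nonneg_nonneg order.antisym less_imp_le mult_zero_right)
    then show ?thesis
      using assms True by simp
  next
    case False
    \<comment> \<open>This is \<open>b\<close> times |c + d z|^2. Replacing \<open>c * b\<close> in
      the first term by the larger \<open>a * d\<close> leaves \<open>d\<close> times the
      target.\<close>
    have "0 \<le> b * ((c + Re z * d)\<^sup>2 + (Im z * d)\<^sup>2)"
      using assms by simp
    also have "\<dots> = c * (c * b) + d * (2 * Re z * (c * b) + (cmod z)\<^sup>2 * (b * d))"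
      unfolding cmod_power2 by (simp add: power2_eq_square algebra_simps)
    also have "\<dots> \<le> c * (a * d) + d * (2 * Re z * (c * b) + (cmod z)\<^sup>2 * (b * d))"
      using assms by simp
    also have "\<dots> = d * (a * c + 2 * Re z * (c * b) + (cmod z)\<^sup>2 * (b * d))"
      by (simp add: algebra_simps)
    finally show ?thesis
      using False assms by (simp add: zero_le_mult_iff)
  qed
  then show "cross ((of_real c + of_real d * z) * s) (z * ((of_real a + of_real b * z) * s)) \<ge> 0"
    using assms by (simp add: cross_sector_eq)
qed

text \<open>All \<open>g t\<close> lie in the sector spanned by \<open>g 0\<close> and \<open>z * g 0\<close>, whose opening is less than
  \<open>\<pi>\<close>; inside it, \<open>cross a b \<ge> 0\<close> orders the arguments and is therefore transitive.\<close>

lemma cross_chain: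
  fixes g :: "nat \<Rightarrow> complex"
  assumes z: "Im z > 0" and nz: "g 0 \<noteq> 0"
    and lo: "\<And>t. t \<le> N \<Longrightarrow> cross (g 0) (g t) \<ge> 0"
    and hi: "\<And>t. t \<le> N \<Longrightarrow> cross (g t) (z * g 0) > 0"
    and nxt: "\<And>t. t < N \<Longrightarrow> cross (g t) (g (Suc t)) \<ge> 0"
    and ij: "i \<le> j" "j \<le> N"
  shows "cross (g i) (g j) \<ge> 0" "cross (g j) (z * g i) \<ge> 0"
proof -
  define m where "m = (cmod (g 0))\<^sup>2 * Im z"
  define a where "a t = cross (g t) (z * g 0) / m" for t
  define b where "b t = cross (g 0) (g t) / m" for t
  have m: "m > 0"
    using z nz by (simp add: m_def)
  have g: "g t = (of_real (a t) + of_real (b t) * z) * g 0" for t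
    unfolding a_def b_def m_def by (rule cross_sector[OF z nz])
  have a: "a t > 0" and b: "b t \<ge> 0" if "t \<le> N" for t
    using hi[OF that] lo[OF that] m by (simp_all add: a_def b_def)
  have nxt': "a t * b (Suc t) \<ge> a (Suc t) * b t" if "t < N" for t
  proof -
    have "m * (a t * b (Suc t) - a (Suc t) * b t) \<ge> 0"
      using nxt[OF that] unfolding m_def g[of t] g[of "Suc t"] cross_sector_eq .
    then show ?thesis
      using m by (simp add: zero_le_mult_iff)
  qed
  \<comment> \<open>The slope \<open>b t / a t\<close> encodes the argument of
    \<open>g t / g 0\<close>. Strictness of \<open>hi\<close> makes \<open>a t\<close> positive, so
    the comparisons of neighbours chain as real inequalities.\<close>
  have "b i / a i \<le> b j / a j"
    using ij
  proof (induction j rule: dec_induct)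
    case base
    then show ?case by simp
  next
    case (step k)
    have "b k / a k \<le> b (Suc k) / a (Suc k)"
      using nxt'[of k] a[of k] a[of "Suc k"] step.prems by (simp add: field_simps)
    then show ?case
      using step by simp
  qed
  then have "a i * b j \<ge> a j * b i"
    using a[of i] a[of j] ij by (simp add: field_simps)
  then show "cross (g i) (g j) \<ge> 0" "cross (g j) (z * g i) \<ge> 0"
    unfolding g[of i] g[of j] using cross_sector_nonneg z a b ij
    by (meson le_trans less_imp_le)+
qed

section \<open>Positivity of Bezout forms of quadratics\<close>

text \<open>Value at \<open>(1, z)\<close> of the Hermitian form with entries \<open>p\<close>,
  \<open>r\<close>, \<open>u\<close>. Multiplied by \<open>p\<close> it is at least |p + r z|^2,
  which is positive because \<open>z\<close> is not real, even when the form is degenerate.\<close>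

lemma hermitian_pos:
  fixes p r u :: real
  assumes "p > 0" "r > 0" "p * u \<ge> r\<^sup>2" "Im z > 0"
  shows "p + 2 * r * Re z + u * (cmod z)\<^sup>2 > 0"
proof -
  have "0 < (p + r * Re z)\<^sup>2 + (r * Im z)\<^sup>2"
    using assms by (simp add: add_nonneg_pos)
  also have "\<dots> = p * p + 2 * p * r * Re z + r\<^sup>2 * (cmod z)\<^sup>2"
    unfolding cmod_power2 by (simp add: power2_eq_square algebra_simps)
  also have "\<dots> \<le> p * p + 2 * p * r * Re z + (p * u) * (cmod z)\<^sup>2"
    using assms by (simp add: mult_right_mono)
  also have "\<dots> = p * (p + 2 * r * Re z + u * (cmod z)\<^sup>2)"
    by (simp add: algebra_simps)
  finally show ?thesis
    using assms by (simp add: zero_less_mult_iff)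
qed

definition quad :: "real \<Rightarrow> real \<Rightarrow> real \<Rightarrow> complex \<Rightarrow> complex" where
  "quad a b c z = of_real a + of_real b * z + of_real c * z\<^sup>2"

text \<open>The three coefficients are the entries of the Bezout matrix of the two quadratics.\<close>

lemma cross_quad:
  "cross (quad a0 a1 a2 z) (quad b0 b1 b2 z)
     = Im z * ((a0 * b1 - a1 * b0) + 2 * (a0 * b2 - a2 * b0) * Re z
               + (a1 * b2 - a2 * b1) * (cmod z)\<^sup>2)"
  by (simp add: cross_def quad_def cmod_power2) (simp add: power2_eq_square algebra_simps)

lemma cross_quad_pos:
  assumes "Im z > 0" "a0 * b1 - a1 * b0 > 0" "a0 * b2 - a2 * b0 > 0"
    "(a0 * b1 - a1 * b0) * (a1 * b2 - a2 * b1) \<ge> (a0 * b2 - a2 * b0)\<^sup>2"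
  shows "cross (quad a0 a1 a2 z) (quad b0 b1 b2 z) > 0"
  unfolding cross_quad using assms by (intro mult_pos_pos hermitian_pos)

lemma cross_quad_times_pos:
  assumes z: "Im z > 0" and c: "c0 > 0" "c2 > 0"
    and p: "c0 * b1 - c1 > 0" and r: "c0 * b2 - c2 > 0"
    and d: "(c0 * b1 - c1) * (c1 * b2 - c2 * b1) \<ge> (c0 * b2 - c2)\<^sup>2"
  shows "cross (quad 1 b1 b2 z) (z * quad c0 c1 c2 z) > 0"
proof -
  \<comment> \<open>Completing the square in the \<open>3 \<times> 3\<close> Bezout form leaves a binary form with entries
    \<open>A\<close>, \<open>c2 * P\<close>, \<open>c2 * R\<close>, whose determinant is \<open>c0 * c2\<close> times that of the assumption.\<close>
  define P where "P = c0 * b1 - c1"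
  define R where "R = c0 * b2 - c2"
  define A where "A = c1 * P - c0 * R"
  have d': "(c0 * b1 - c1) * (c1 * b2 - c2 * b1) - R\<^sup>2 \<ge> 0"
    using d by (simp add: R_def)
  have AR: "A * R = c0 * ((c0 * b1 - c1) * (c1 * b2 - c2 * b1) - R\<^sup>2) + c2 * P\<^sup>2"
    by (simp add: A_def P_def R_def power2_eq_square algebra_simps)
  have "A * R > 0"
    unfolding AR using c p d' by (intro add_nonneg_pos) (simp_all add: P_def)
  then have "A > 0"
    using r by (simp add: R_def zero_less_mult_iff)
  have "c2 * c0 * ((c0 * b1 - c1) * (c1 * b2 - c2 * b1) - R\<^sup>2) = A * (c2 * R) - (c2 * P)\<^sup>2"
    using arg_cong[OF AR, of "\<lambda>t. c2 * t"] by (simp add: power2_eq_square algebra_simps)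
  then have "A * (c2 * R) \<ge> (c2 * P)\<^sup>2"
    using d' c by (metis diff_ge_0_iff_ge less_imp_le mult_nonneg_nonneg)
  then have pos: "A + 2 * (c2 * P) * Re z + (c2 * R) * (cmod z)\<^sup>2 > 0"
    using \<open>A > 0\<close> c p z by (intro hermitian_pos) (simp_all add: P_def)
  have "c0 * cross (quad 1 b1 b2 z) (z * quad c0 c1 c2 z)
      = Im z * ((cmod (quad c0 c1 c2 z))\<^sup>2
          + (cmod z)\<^sup>2 * (A + 2 * (c2 * P) * Re z + (c2 * R) * (cmod z)\<^sup>2))"
    by (simp add: cross_def quad_def cmod_power2 A_def P_def R_def)
      (simp add: power2_eq_square algebra_simps)
  also have "\<dots> > 0"
    using z by (intro mult_pos_pos[OF z] add_nonneg_pos[OF zero_le_power2] mult_pos_pos[OF _ pos]) auto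
  finally show ?thesis
    using c by (simp add: zero_less_mult_iff)
qed

section \<open>Signed permutations and their last entry\<close>

definition letters :: "nat \<Rightarrow> int set" where
  "letters n = {- int n..int n} - {0}"

lemma finite_letters [simp]: "finite (letters n)"
  by (simp add: letters_def)

lemma letters_iff: "i \<in> letters n \<longleftrightarrow> i \<noteq> 0 \<and> \<bar>i\<bar> \<le> int n"
  by (auto simp: letters_def)

text \<open>Outside \<open>letters n\<close> the function is the identity, which is odd; so oddness
  can be used at every integer.\<close>

lemma signed_perms_iff:
  "\<sigma> \<in> signed_perms n \<longleftrightarrow> \<sigma> permutes letters n \<and> (\<forall>i. \<sigma> (- i) = - \<sigma> i)"
proof -
  have "\<sigma> (- i) = - \<sigma> i" if "\<sigma> permutes letters n" "i \<notin> letters n" for i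
    using that by (auto simp: letters_iff permutes_def)
  then show ?thesis
    unfolding signed_perms_def letters_def[symmetric] by blast
qed

lemma finite_signed_perms [simp]: "finite (signed_perms n)"
  by (rule finite_subset[OF _ finite_permutations[OF finite_letters[of n]]])
    (auto simp: signed_perms_iff)

lemma signed_perms_letters: "\<sigma> \<in> signed_perms n \<Longrightarrow> i \<in> letters n \<Longrightarrow> \<sigma> i \<in> letters n"
  by (simp add: signed_perms_iff permutes_in_image)

lemma signed_perms_fix: "\<sigma> \<in> signed_perms n \<Longrightarrow> int n < i \<Longrightarrow> \<sigma> i = i"
  by (auto simp: signed_perms_iff letters_iff permutes_def)

lemma signed_perms_compose:
  "\<sigma> \<in> signed_perms n \<Longrightarrow> \<tau> \<in> signed_perms n \<Longrightarrow> \<sigma> \<circ> \<tau> \<in> signed_perms n"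
  by (simp add: signed_perms_iff permutes_compose)

lemma signed_perms_inv:
  assumes "\<sigma> \<in> signed_perms n"
  shows "inv \<sigma> \<in> signed_perms n"
proof -
  have p: "\<sigma> permutes letters n" and odd: "\<And>i. \<sigma> (- i) = - \<sigma> i"
    using assms by (auto simp: signed_perms_iff)
  have "inv \<sigma> (- i) = - inv \<sigma> i" for i
    unfolding permutes_inv_eq[OF p] using odd permutes_inverses(1)[OF p] by simp
  then show ?thesis
    using permutes_inv[OF p] by (simp add: signed_perms_iff)
qed

lemma signed_perms_Suc:
  "\<sigma> \<in> signed_perms n \<longleftrightarrow> \<sigma> \<in> signed_perms (Suc n) \<and> \<sigma> (int (Suc n)) = int (Suc n)"
proof
  assume *: "\<sigma> \<in> signed_perms n"
  have "letters n \<subseteq> letters (Suc n)"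
    by (auto simp: letters_def)
  then show "\<sigma> \<in> signed_perms (Suc n) \<and> \<sigma> (int (Suc n)) = int (Suc n)"
    using * signed_perms_fix[OF *, of "int (Suc n)"] permutes_subset[of \<sigma> "letters n" "letters (Suc n)"]
    by (simp add: signed_perms_iff)
next
  assume *: "\<sigma> \<in> signed_perms (Suc n) \<and> \<sigma> (int (Suc n)) = int (Suc n)"
  have "\<sigma> i = i" if "i \<in> letters (Suc n) - letters n" for i
  proof -
    have "i = int (Suc n) \<or> i = - int (Suc n)"
      using that by (auto simp: letters_iff)
    then show ?thesis
      using * by (auto simp: signed_perms_iff simp del: of_nat_Suc)
  qed
  then show "\<sigma> \<in> signed_perms n"
    using * permutes_superset[of \<sigma> "letters (Suc n)" "letters n"] by (simp add: signed_perms_iff)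
qed

text \<open>Sends \<open>n\<close> to \<open>k\<close> and is strictly increasing on \<open>{\<plusminus>1, \<dots>, \<plusminus>(n - 1)}\<close>, so composing with it
  appends the last entry \<open>k\<close> to a signed permutation without changing the earlier descents.\<close>

definition coset_rep :: "nat \<Rightarrow> int \<Rightarrow> int \<Rightarrow> int" where
  "coset_rep n k j =
     (if j = int n then k else if j = - int n then - k
      else if \<bar>j\<bar> < \<bar>k\<bar> \<or> int n < \<bar>j\<bar> then j else if j > 0 then j + 1 else j - 1)"

lemma coset_rep_top [simp]: "coset_rep n k (int n) = k"
  by (simp add: coset_rep_def)

lemma coset_rep_signed_perms:
  assumes "k \<in> letters n"
  shows "coset_rep n k \<in> signed_perms n"
proof -
  have inj: "inj_on (coset_rep n k) (letters n)"
  proof (rule inj_on_inverseI)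
    fix j
    assume j: "j \<in> letters n"
    consider "j = int n" | "j = - int n" | "\<bar>j\<bar> < int n" "\<bar>j\<bar> < \<bar>k\<bar>"
      | "0 < j" "j < int n" "\<bar>k\<bar> \<le> j" | "j < 0" "- int n < j" "\<bar>k\<bar> \<le> - j"
      using j by (fastforce simp: letters_iff)
    \<comment> \<open>An explicit left inverse: images beyond \<bar>k\<bar> in absolute value move
      one step back towards 0.\<close>
    then show "(if coset_rep n k j = k then int n else if coset_rep n k j = - k then - int n
        else if \<bar>coset_rep n k j\<bar> < \<bar>k\<bar> then coset_rep n k j
        else coset_rep n k j - sgn (coset_rep n k j)) = j"
      using assms j by cases (auto simp: letters_iff coset_rep_def)
  qed
  have "coset_rep n k ` letters n \<subseteq> letters n"
    using assms unfolding image_subset_iff coset_rep_def by (auto simp: letters_iff split: if_splits)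
  with inj have "bij_betw (coset_rep n k) (letters n) (letters n)"
    by (simp add: bij_betw_def endo_inj_surj)
  then have "coset_rep n k permutes letters n"
    by (rule bij_imp_permutes) (use assms in \<open>auto simp: coset_rep_def letters_iff\<close>)
  moreover have "coset_rep n k (- i) = - coset_rep n k i" for i
    using assms by (auto simp: coset_rep_def letters_iff)
  ultimately show ?thesis
    by (simp add: signed_perms_iff)
qed

text \<open>Fixing the last entry selects a left coset of the stabilizer of
  \<open>int (Suc m)\<close>, and that stabilizer is \<open>signed_perms m\<close>.\<close>

lemma bij_betw_coset_rep:
  assumes k: "k \<in> letters (Suc m)"
  shows "bij_betw (\<lambda>\<tau>. coset_rep (Suc m) k \<circ> \<tau>) (signed_perms m)
           {\<sigma> \<in> signed_perms (Suc m). \<sigma> (int (Suc m)) = k}"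
proof -
  let ?c = "coset_rep (Suc m) k"
  have c: "?c \<in> signed_perms (Suc m)"
    by (rule coset_rep_signed_perms[OF k])
  then have p: "?c permutes letters (Suc m)"
    by (simp add: signed_perms_iff)
  show ?thesis
  proof (rule bij_betwI[where g = "\<lambda>\<sigma>. inv ?c \<circ> \<sigma>"])
    show "(\<lambda>\<tau>. ?c \<circ> \<tau>) \<in> signed_perms m \<rightarrow> {\<sigma> \<in> signed_perms (Suc m). \<sigma> (int (Suc m)) = k}"
      using signed_perms_compose[OF c] signed_perms_Suc[of _ m] by (auto simp del: of_nat_Suc)
    show "(\<lambda>\<sigma>. inv ?c \<circ> \<sigma>) \<in> {\<sigma> \<in> signed_perms (Suc m). \<sigma> (int (Suc m)) = k} \<rightarrow> signed_perms m"
      using signed_perms_compose[OF signed_perms_inv[OF c]] signed_perms_Suc[of _ m]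
      by (auto simp: permutes_inv_eq[OF p] simp del: of_nat_Suc)
  qed (auto simp: fun_eq_iff permutes_inverses[OF p])
qed

text \<open>The condition on the last entry \<open>j\<close> before relabelling by \<open>coset_rep\<close>: relabelling shifts
  \<open>j\<close> away from \<open>0\<close> when \<open>\<bar>j\<bar> \<ge> \<bar>k\<bar>\<close>, hence the asymmetry at \<open>j = k\<close>.\<close>

definition descends :: "int \<Rightarrow> int \<Rightarrow> bool" where
  "descends k j \<longleftrightarrow> (if k > 0 then k \<le> j else k < j)"

definition weight :: "nat \<Rightarrow> real \<Rightarrow> complex \<Rightarrow> (int \<Rightarrow> int) \<Rightarrow> complex" where
  "weight n q z \<sigma> = of_real (q ^ neg_D n \<sigma>) * z ^ des_D n \<sigma>"

section \<open>The statistics after appending a last entry\<close>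

lemma coset_rep_neg_iff:
  "j \<in> letters m \<Longrightarrow> coset_rep (Suc m) k j < 0 \<longleftrightarrow> j < 0"
  by (auto simp: coset_rep_def letters_iff)

lemma coset_rep_less_iff:
  "i \<in> letters m \<Longrightarrow> j \<in> letters m \<Longrightarrow> coset_rep (Suc m) k i < coset_rep (Suc m) k j \<longleftrightarrow> i < j"
  by (auto simp: coset_rep_def letters_iff)

text \<open>\<open>i + j < 0\<close> means \<open>i < - j\<close>, and the relabelling is odd and
  increasing on \<open>letters m\<close>. This preserves the descent at 0.\<close>

lemma coset_rep_add_neg_iff:
  "i \<in> letters m \<Longrightarrow> j \<in> letters m \<Longrightarrow>
    coset_rep (Suc m) k i + coset_rep (Suc m) k j < 0 \<longleftrightarrow> i + j < 0"
  by (auto simp: coset_rep_def letters_iff)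

lemma coset_rep_greater_iff:
  "j \<in> letters m \<Longrightarrow> k \<in> letters (Suc m) \<Longrightarrow> k < coset_rep (Suc m) k j \<longleftrightarrow> descends k j"
  by (auto simp: coset_rep_def letters_iff descends_def)

lemma neg_D_coset_rep:
  assumes "m \<ge> 2" and \<tau>: "\<tau> \<in> signed_perms m"
  shows "neg_D (Suc m) (coset_rep (Suc m) k \<circ> \<tau>) = neg_D m \<tau> + (if k < 0 then 1 else 0)"
proof -
  let ?\<sigma> = "coset_rep (Suc m) k \<circ> \<tau>"
  have top: "?\<sigma> (int (Suc m)) = k"
    using signed_perms_fix[OF \<tau>, of "int (Suc m)"] by (simp del: of_nat_Suc)
  have low: "?\<sigma> i < 0 \<longleftrightarrow> \<tau> i < 0" if "i \<in> {2..int m}" for i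
    using coset_rep_neg_iff[OF signed_perms_letters[OF \<tau>], of i] that by (simp add: letters_iff)
  have I: "{2..int (Suc m)} = insert (int (Suc m)) {2..int m}"
    using assms by auto
  have "{i \<in> {2..int (Suc m)}. ?\<sigma> i < 0}
      = {i \<in> {2..int m}. \<tau> i < 0} \<union> (if k < 0 then {int (Suc m)} else {})"
    unfolding I using low top by (auto simp del: of_nat_Suc o_apply)
  moreover have "finite {i \<in> {2..int m}. \<tau> i < 0}"
    by (rule finite_subset[of _ "{2..int m}"]) auto
  ultimately show ?thesis
    by (simp add: neg_D_def)
qed

lemma des_D_coset_rep:
  assumes m: "m \<ge> 2" and \<tau>: "\<tau> \<in> signed_perms m" and k: "k \<in> letters (Suc m)"
  shows "des_D (Suc m) (coset_rep (Suc m) k \<circ> \<tau>)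
           = des_D m \<tau> + (if descends k (\<tau> (int m)) then 1 else 0)"
proof -
  let ?\<sigma> = "coset_rep (Suc m) k \<circ> \<tau>"
  have top: "?\<sigma> (int (Suc m)) = k"
    using signed_perms_fix[OF \<tau>, of "int (Suc m)"] by (simp del: of_nat_Suc)
  have letters: "\<tau> i \<in> letters m" if "i \<in> {1..int m}" for i
    using signed_perms_letters[OF \<tau>, of i] that by (simp add: letters_iff)
  have low: "?\<sigma> i > ?\<sigma> (i + 1) \<longleftrightarrow> \<tau> i > \<tau> (i + 1)" if "i \<in> {1..int m - 1}" for i
    using coset_rep_less_iff[OF letters[of "i + 1"] letters[of i]] that by simp
  have last: "?\<sigma> (int m) > ?\<sigma> (int m + 1) \<longleftrightarrow> descends k (\<tau> (int m))"
    using coset_rep_greater_iff[OF letters[of "int m"] k] top m by (simp add: add.commute)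
  have first: "?\<sigma> 1 + ?\<sigma> 2 < 0 \<longleftrightarrow> \<tau> 1 + \<tau> 2 < 0"
    using coset_rep_add_neg_iff[OF letters[of 1] letters[of 2]] m by simp
  have "{i \<in> {1..int (Suc m) - 1}. ?\<sigma> i > ?\<sigma> (i + 1)}
      = {i \<in> {1..int m - 1}. \<tau> i > \<tau> (i + 1)}
        \<union> (if descends k (\<tau> (int m)) then {int m} else {})" (is "?L = ?R")
  proof (rule set_eqI)
    fix i
    show "i \<in> ?L \<longleftrightarrow> i \<in> ?R"
    proof (cases "i = int m")
      case True
      then show ?thesis
        using last m by (simp del: o_apply)
    next
      case False
      then have "i \<in> {1..int (Suc m) - 1} \<longleftrightarrow> i \<in> {1..int m - 1}"
        by auto
      then show ?thesis
        using low[of i] False by (cases "i \<in> {1..int m - 1}") (auto simp del: o_apply)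
    qed
  qed
  then have "Des_D (Suc m) ?\<sigma> = Des_D m \<tau> \<union> (if descends k (\<tau> (int m)) then {int m} else {})"
    unfolding Des_D_def first by (metis Un_assoc)
  moreover have "finite (Des_D m \<tau>)"
    by (rule finite_subset[of _ "{0..int m}"]) (auto simp: Des_D_def)
  moreover have "int m \<notin> Des_D m \<tau>"
    using m by (auto simp: Des_D_def)
  ultimately show ?thesis
    by (simp add: des_D_def)
qed

section \<open>Sums refined by the last entry\<close>

definition last_sum :: "real \<Rightarrow> complex \<Rightarrow> nat \<Rightarrow> int \<Rightarrow> complex" where
  "last_sum q z n k = (\<Sum>\<sigma> | \<sigma> \<in> signed_perms n \<and> \<sigma> (int n) = k. weight n q z \<sigma>)"

text \<open>The constant \<open>f\<close> gives the full sum; a factor \<open>z\<close> on some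
  entries gives the right-hand side of the recurrence.\<close>

lemma sum_weight_eq_sum_last_sum:
  assumes "n \<ge> 1"
  shows "(\<Sum>\<sigma>\<in>signed_perms n. f (\<sigma> (int n)) * weight n q z \<sigma>) = (\<Sum>k\<in>letters n. f k * last_sum q z n k)"
proof -
  have "(\<Sum>\<sigma>\<in>signed_perms n. f (\<sigma> (int n)) * weight n q z \<sigma>)
      = (\<Sum>k\<in>letters n. \<Sum>\<sigma> | \<sigma> \<in> signed_perms n \<and> \<sigma> (int n) = k. f (\<sigma> (int n)) * weight n q z \<sigma>)"
  proof (rule sum.group[symmetric])
    show "(\<lambda>\<sigma>. \<sigma> (int n)) ` signed_perms n \<subseteq> letters n"
      using signed_perms_letters[of _ n "int n"] assms by (auto simp: letters_iff[of "int n"])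
  qed simp_all
  also have "\<dots> = (\<Sum>k\<in>letters n. f k * last_sum q z n k)"
    unfolding last_sum_def sum_distrib_left by (intro sum.cong refl) auto
  finally show ?thesis .
qed

lemma last_sum_Suc:
  assumes m: "m \<ge> 2" and k: "k \<in> letters (Suc m)"
  shows "last_sum q z (Suc m) k = (if k < 0 then of_real q else 1)
           * (\<Sum>j\<in>letters m. (if descends k j then z else 1) * last_sum q z m j)"
proof -
  have "last_sum q z (Suc m) k = (\<Sum>\<tau>\<in>signed_perms m. weight (Suc m) q z (coset_rep (Suc m) k \<circ> \<tau>))"
    unfolding last_sum_def
    using sum.reindex_bij_betw[OF bij_betw_coset_rep[OF k], of "weight (Suc m) q z"] by simp
  also have "\<dots> = (\<Sum>\<tau>\<in>signed_perms m. (if k < 0 then of_real q else 1)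
      * ((if descends k (\<tau> (int m)) then z else 1) * weight m q z \<tau>))"
    by (intro sum.cong refl) (simp add: weight_def neg_D_coset_rep des_D_coset_rep m k)
  also have "\<dots> = (if k < 0 then of_real q else 1)
      * (\<Sum>j\<in>letters m. (if descends k j then z else 1) * last_sum q z m j)"
    unfolding sum_distrib_left[symmetric] using m by (subst sum_weight_eq_sum_last_sum) auto
  finally show ?thesis .
qed

text \<open>Isolates positions 0 and 1, the only ones that involve
  \<open>\<sigma> 1\<close>.\<close>

lemma des_D_split:
  assumes "n \<ge> 2"
  shows "des_D n \<sigma> = (if \<sigma> 1 + \<sigma> 2 < 0 then 1 else 0) + (if \<sigma> 1 > \<sigma> 2 then 1 else 0)
           + card {i \<in> {2..int n - 1}. \<sigma> i > \<sigma> (i + 1)}"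
proof -
  have I: "{1..int n - 1} = insert 1 {2..int n - 1}"
    using assms by auto
  have "Des_D n \<sigma> = (if \<sigma> 1 + \<sigma> 2 < 0 then {0} else {}) \<union> (if \<sigma> 1 > \<sigma> 2 then {1} else {})
      \<union> {i \<in> {2..int n - 1}. \<sigma> i > \<sigma> (i + 1)}"
    unfolding Des_D_def I by auto
  moreover have "finite {i \<in> {2..int n - 1}. \<sigma> i > \<sigma> (i + 1)}"
    by (rule finite_subset[of _ "{2..int n - 1}"]) auto
  ultimately show ?thesis
    by (simp add: des_D_def)
qed

text \<open>Changing the sign of \<open>\<sigma> 1\<close> exchanges the conditions for the descents \<open>0\<close> and \<open>1\<close>.\<close>

lemma sum_weight_even:
  assumes n: "n \<ge> 2"
  shows "(\<Sum>\<sigma>\<in>signed_perms n. weight n q z \<sigma>) = 2 * (\<Sum>\<sigma>\<in>even_signed_perms n. weight n q z \<sigma>)"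
proof -
  \<comment> \<open>\<open>c\<close> swaps 1 and -1 and fixes all else, so composing with it on the
    right negates \<open>\<sigma> 1\<close> only.\<close>
  define c where "c = coset_rep 1 (-1)"
  have c1: "c 1 = -1" "c (-1) = 1" and c_other: "\<And>i. i > 1 \<Longrightarrow> c i = i"
    by (simp_all add: c_def coset_rep_def)
  have "c \<in> signed_perms 1"
    unfolding c_def by (rule coset_rep_signed_perms) (simp add: letters_iff)
  then have "c \<in> signed_perms (Suc m)" for m
  proof (induction m)
    case (Suc m)
    then show ?case
      using signed_perms_Suc[of c "Suc m"] by simp
  qed simp
  then have c: "c \<in> signed_perms n"
    using n by (cases n) auto
  have cc: "c (c i) = i" for i
    by (auto simp: c_def coset_rep_def)
  have neg: "neg_D n (\<sigma> \<circ> c) = neg_D n \<sigma>" for \<sigma>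
    unfolding neg_D_def by (intro arg_cong[where f = card]) (auto simp: c_other)
  have des: "des_D n (\<sigma> \<circ> c) = des_D n \<sigma>" if "\<sigma> \<in> signed_perms n" for \<sigma>
  proof -
    have "{i \<in> {2..int n - 1}. (\<sigma> \<circ> c) i > (\<sigma> \<circ> c) (i + 1)}
        = {i \<in> {2..int n - 1}. \<sigma> i > \<sigma> (i + 1)}"
      by (auto simp: c_other)
    moreover have "\<sigma> (-1) = - \<sigma> 1"
      using that by (simp add: signed_perms_iff)
    ultimately show ?thesis
      unfolding des_D_split[OF n] by (auto simp: c1 c_other)
  qed
  \<comment> \<open>Given the later entries, the parity condition determines the sign of
    \<open>\<sigma> 1\<close>; hence the sign change exchanges even and odd elements.\<close>
  have even_iff: "\<sigma> \<in> even_signed_perms n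
      \<longleftrightarrow> \<sigma> \<in> signed_perms n \<and> (even (neg_D n \<sigma>) \<longleftrightarrow> \<sigma> 1 > 0)" for \<sigma>
  proof (cases "\<sigma> \<in> signed_perms n")
    case True
    have I: "{1..int n} = insert 1 {2..int n}"
      using n by auto
    have "{i \<in> {1..int n}. \<sigma> i < 0}
        = (if \<sigma> 1 < 0 then {1} else {}) \<union> {i \<in> {2..int n}. \<sigma> i < 0}"
      unfolding I by auto
    moreover have "finite {i \<in> {2..int n}. \<sigma> i < 0}"
      by (rule finite_subset[of _ "{2..int n}"]) auto
    ultimately have "card {i \<in> {1..int n}. \<sigma> i < 0} = (if \<sigma> 1 < 0 then 1 else 0) + neg_D n \<sigma>"
      by (simp add: neg_D_def)
    moreover have "\<sigma> 1 \<noteq> 0"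
      using signed_perms_letters[OF True, of 1] n by (auto simp: letters_iff)
    ultimately show ?thesis
      using True by (auto simp: even_signed_perms_def)
  qed (simp add: even_signed_perms_def)
  let ?odd = "signed_perms n - even_signed_perms n"
  have sign: "(\<sigma> \<circ> c) 1 > 0 \<longleftrightarrow> \<not> \<sigma> 1 > 0" if "\<sigma> \<in> signed_perms n" for \<sigma>
    using signed_perms_letters[OF that, of 1] that n by (auto simp: letters_iff c1 signed_perms_iff)
  have flip: "\<sigma> \<circ> c \<in> even_signed_perms n \<longleftrightarrow> \<sigma> \<notin> even_signed_perms n"
    if "\<sigma> \<in> signed_perms n" for \<sigma>
    unfolding even_iff neg using sign[OF that] signed_perms_compose[OF that c] that by auto
  have "bij_betw (\<lambda>\<sigma>. \<sigma> \<circ> c) (even_signed_perms n) ?odd"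
    by (rule bij_betwI[where g = "\<lambda>\<sigma>. \<sigma> \<circ> c"])
      (use flip signed_perms_compose[OF _ c] even_iff in \<open>auto simp: fun_eq_iff cc\<close>)
  then have "(\<Sum>\<sigma>\<in>?odd. weight n q z \<sigma>) = (\<Sum>\<sigma>\<in>even_signed_perms n. weight n q z (\<sigma> \<circ> c))"
    by (rule sum.reindex_bij_betw[symmetric])
  also have "\<dots> = (\<Sum>\<sigma>\<in>even_signed_perms n. weight n q z \<sigma>)"
    by (intro sum.cong refl) (simp add: weight_def neg des even_iff)
  finally have "(\<Sum>\<sigma>\<in>?odd. weight n q z \<sigma>) = (\<Sum>\<sigma>\<in>even_signed_perms n. weight n q z \<sigma>)" .
  moreover have "even_signed_perms n \<subseteq> signed_perms n"
    by (auto simp: even_signed_perms_def)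
  ultimately show ?thesis
    using sum.subset_diff[of "even_signed_perms n" "signed_perms n" "weight n q z"] by simp
qed

section \<open>Interlacing of the refined sums\<close>

text \<open>Larger indices come first, because a smaller last entry produces more descents and so
  more factors \<open>z\<close>.\<close>

definition interlacing :: "complex \<Rightarrow> int set \<Rightarrow> (int \<Rightarrow> complex) \<Rightarrow> bool" where
  "interlacing z J f \<longleftrightarrow>
     (\<forall>i\<in>J. \<forall>j\<in>J. i < j \<longrightarrow> cross (f j) (f i) \<ge> 0 \<and> cross (f i) (z * f j) \<ge> 0)"

text \<open>The up-sets \<open>U\<close> and \<open>V\<close> cut \<open>J\<close> into three
  consecutive blocks, whose sums are the \<open>a\<close>, \<open>b\<close>, \<open>c\<close> of
  \<open>cross_step\<close>.\<close>

lemma cross_nonneg_add_cases: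
  assumes "interlacing z J f" "Im z > 0" "finite J" "U \<subseteq> V" "V \<subseteq> J"
    and up: "\<And>i j. i \<in> U \<Longrightarrow> j \<in> J \<Longrightarrow> i < j \<Longrightarrow> j \<in> U"
      "\<And>i j. i \<in> V \<Longrightarrow> j \<in> J \<Longrightarrow> i < j \<Longrightarrow> j \<in> V"
  shows "cross (\<Sum>j\<in>J. (if j \<in> U then z else 1) * f j) (\<Sum>j\<in>J. (if j \<in> V then z else 1) * f j) \<ge> 0"
      (is "cross ?u ?v \<ge> 0")
    and "cross (\<Sum>j\<in>J. (if j \<in> V then z else 1) * f j) (z * (\<Sum>j\<in>J. (if j \<in> U then z else 1) * f j)) \<ge> 0"
proof -
  have fin: "finite U" "finite V"
    using assms by (meson finite_subset order_trans)+
  have split: "sum g J = sum g U + sum g (V - U) + sum g (J - V)" for g :: "int \<Rightarrow> complex"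
    using sum.subset_diff[of V J g] sum.subset_diff[of U V g] assms fin by (simp add: ac_simps)
  define a where "a = sum f U"
  define b where "b = sum f (V - U)"
  define c where "c = sum f (J - V)"
  have u: "?u = z * a + b + c"
    unfolding split a_def b_def c_def sum_distrib_left using assms
    by (intro arg_cong2[where f = "(+)"] sum.cong) auto
  have v: "?v = z * a + z * b + c"
    unfolding split a_def b_def c_def sum_distrib_left using assms
    by (intro arg_cong2[where f = "(+)"] sum.cong) auto
  have gt: "cross (f i) (f j) \<ge> 0 \<and> cross (f j) (z * f i) \<ge> 0" if "i \<in> J" "j \<in> J" "j < i" for i j
    using assms(1) that by (auto simp: interlacing_def)
  have ab: "j < i" if "i \<in> U" "j \<in> V - U" for i j
    using up(1)[of i j] that assms(5) by (cases i j rule: linorder_cases) auto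
  have bc: "j < i" if "i \<in> V - U" "j \<in> J - V" for i j
    using up(2)[of i j] that by (cases i j rule: linorder_cases) auto
  have JU: "i \<in> J" if "i \<in> U" for i
    using that assms by blast
  have "cross (f i) (f j) \<ge> 0" "cross (f j) (z * f i) \<ge> 0" if "i \<in> U" "j \<in> V - U" for i j
    using gt[of i j] ab[OF that] JU[of i] that assms(5) by auto
  moreover have "cross (f i) (f j) \<ge> 0" "cross (f j) (z * f i) \<ge> 0" if "i \<in> V - U" "j \<in> J - V" for i j
    using gt[of i j] bc[OF that] that assms(5) by auto
  ultimately have "cross a b \<ge> 0" "cross b (z * a) \<ge> 0" "cross b c \<ge> 0" "cross c (z * b) \<ge> 0"
    unfolding a_def b_def c_def sum_distrib_left by (auto intro!: cross_sum_nonneg)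
  then show "cross ?u ?v \<ge> 0" "cross ?v (z * ?u) \<ge> 0"
    unfolding u v using cross_step[of z a b c] assms by auto
qed

lemma descends_mono: "descends k i \<Longrightarrow> i < j \<Longrightarrow> descends k j"
  by (auto simp: descends_def split: if_splits)

lemma descends_antimono: "descends l j \<Longrightarrow> k < l \<Longrightarrow> k \<noteq> 0 \<Longrightarrow> j \<noteq> 0 \<Longrightarrow> descends k j"
  by (auto simp: descends_def split: if_splits)

lemma cross_weights_nonneg:
  "cross a b \<ge> 0 \<Longrightarrow> r \<ge> 0 \<Longrightarrow> s \<ge> 0 \<Longrightarrow> cross (of_real r * a) (of_real s * b) \<ge> 0"
  by (simp add: cross_scale_left cross_scale_right)

lemma cross_weights_nonneg':
  "cross a (z * b) \<ge> 0 \<Longrightarrow> r \<ge> 0 \<Longrightarrow> s \<ge> 0 \<Longrightarrow> cross (of_real r * a) (z * (of_real s * b)) \<ge> 0"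
  using cross_weights_nonneg[of a "z * b" r s] by (simp add: ac_simps)

lemma interlacing_last_sum_Suc:
  assumes m: "m \<ge> 2" and q: "q > 0" and z: "Im z > 0"
    and "interlacing z (letters m) (last_sum q z m)"
  shows "interlacing z (letters (Suc m)) (last_sum q z (Suc m))"
proof -
  define w where "w k = (if k < 0 then q else 1)" for k :: int
  define U where "U k = {j \<in> letters m. descends k j}" for k
  have E: "last_sum q z (Suc m) k
      = of_real (w k) * (\<Sum>j\<in>letters m. (if j \<in> U k then z else 1) * last_sum q z m j)"
    if "k \<in> letters (Suc m)" for k
    unfolding last_sum_Suc[OF m that] U_def w_def
    by (intro arg_cong2[where f = "(*)"] sum.cong) auto
  have w: "w k \<ge> 0" for k
    using q by (simp add: w_def)
  show ?thesis
    unfolding interlacing_def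
  proof (intro ballI impI)
    fix i j
    assume ij: "i \<in> letters (Suc m)" "j \<in> letters (Suc m)" "i < j"
    \<comment> \<open>A larger last entry makes fewer previous entries descend, so the threshold
      sets are nested.\<close>
    have sub: "U j \<subseteq> U i" "U i \<subseteq> letters m"
      using descends_antimono[of j _ i] ij by (auto simp: U_def letters_iff)
    have up: "l' \<in> U k" if "l \<in> U k" "l' \<in> letters m" "l < l'" for l l' k
      using that descends_mono by (auto simp: U_def)
    show "cross (last_sum q z (Suc m) j) (last_sum q z (Suc m) i) \<ge> 0
        \<and> cross (last_sum q z (Suc m) i) (z * last_sum q z (Suc m) j) \<ge> 0"
      unfolding E[OF ij(1)] E[OF ij(2)]
      using cross_nonneg_add_cases[OF assms(4) z finite_letters sub up up]
      by (intro conjI cross_weights_nonneg cross_weights_nonneg' w)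
  qed
qed

text \<open>The largest last entry never creates a descent, the smallest one always does.\<close>

lemma sum_last_sum_Suc:
  assumes "m \<ge> 2"
  shows "last_sum q z (Suc m) (int (Suc m)) = (\<Sum>j\<in>letters m. last_sum q z m j)"
    and "last_sum q z (Suc m) (- int (Suc m)) = of_real q * z * (\<Sum>j\<in>letters m. last_sum q z m j)"
  using assms by (subst last_sum_Suc; auto simp: letters_iff descends_def sum_distrib_left mult.assoc
    intro!: sum.cong)+

text \<open>Pairing with the first member is a real-linear functional, nonnegative on all members
  and strictly positive on the last. It is therefore positive on their sum.\<close>

lemma sum_last_sum_Suc_nonzero:
  assumes m: "m \<ge> 2" and q: "q > 0" and z: "Im z > 0"
    and inter: "interlacing z (letters (Suc m)) (last_sum q z (Suc m))"
    and nz: "(\<Sum>j\<in>letters m. last_sum q z m j) \<noteq> 0"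
  shows "(\<Sum>j\<in>letters (Suc m). last_sum q z (Suc m) j) \<noteq> 0"
proof -
  let ?f = "last_sum q z (Suc m)" and ?t = "int (Suc m)"
  have t: "?t \<in> letters (Suc m)" "- ?t \<in> letters (Suc m)"
    by (auto simp: letters_iff)
  have "cross (?f ?t) (?f j) \<ge> 0" if "j \<in> letters (Suc m)" for j
  proof (cases "j = ?t")
    case False
    then have "j < ?t"
      using that by (auto simp: letters_iff)
    then show ?thesis
      using inter t that by (auto simp: interlacing_def)
  qed simp
  moreover have "cross (?f ?t) (?f (- ?t)) > 0"
    using q z nz unfolding sum_last_sum_Suc[OF m] by (simp add: mult.assoc cross_scale_right cross_mult_self)
  ultimately have "0 < (\<Sum>j\<in>letters (Suc m). cross (?f ?t) (?f j))"
    using t(2) by (intro sum_pos2[of _ "- ?t"]) auto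
  also have "\<dots> = cross (?f ?t) (\<Sum>j\<in>letters (Suc m). ?f j)"
    by (simp add: cross_def sum_distrib_right)
  finally show ?thesis
    by auto
qed

section \<open>The base case\<close>

text \<open>Naming the Bezout entries \<open>p\<close>, \<open>r\<close>, \<open>u\<close> and the
  discriminant \<open>d\<close> reduces each concrete case to polynomial identities and visible
  signs.\<close>

lemma cross_quad_pos':
  assumes "Im z > 0" "a0 * b1 - a1 * b0 = p" "a0 * b2 - a2 * b0 = r" "a1 * b2 - a2 * b1 = u"
    "p * u - r\<^sup>2 = d" "p > 0" "r > 0" "d \<ge> 0"
  shows "cross (quad a0 a1 a2 z) (quad b0 b1 b2 z) > 0"
  using cross_quad_pos[of z a0 b1 a1 b0 b2 a2] assms by simp

text \<open>Here \<open>b\<close> and \<open>z * c\<close> are the sums over the entries that do and do not receive the factor \<open>z\<close>.\<close>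

definition cross_block :: "complex \<Rightarrow> complex \<Rightarrow> complex \<Rightarrow> bool" where
  "cross_block z b c \<longleftrightarrow> cross b (z * c) > 0 \<and> cross (z * c) (z * b) > 0"

lemma cross_block_quad:
  assumes "Im z > 0" "c0 * b1 - c1 * 1 = p" "c0 * b2 - c2 * 1 = r" "c1 * b2 - c2 * b1 = u"
    "p * u - r\<^sup>2 = d" "p > 0" "r > 0" "d \<ge> 0" "c0 > 0" "c2 > 0"
  shows "cross_block z (quad 1 b1 b2 z) (quad c0 c1 c2 z)"
proof -
  have "cross (quad c0 c1 c2 z) (quad 1 b1 b2 z) > 0"
    by (rule cross_quad_pos'[OF assms(1-8)])
  moreover have "cross (quad 1 b1 b2 z) (z * quad c0 c1 c2 z) > 0"
    by (rule cross_quad_times_pos) (use assms in auto)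
  ultimately show ?thesis
    using assms(1) by (auto simp: cross_block_def cross_mult_both intro!: mult_pos_pos)
qed

text \<open>Bilinear expansion; the first claim is \<open>cross_step\<close> with empty first block.
  Strict positivity in the second forces \<open>b + z * c\<close> to be nonzero.\<close>

lemma cross_block_combine:
  assumes z: "Im z > 0" and "cross_block z b c"
  shows "cross (b + z * c) (z * b + z * c) \<ge> 0"
    and "cross (z * b + z * c) (z * (b + z * c)) > 0"
    and "b + z * c \<noteq> 0"
proof -
  have pos: "cross b (z * c) > 0" "cross (z * c) (z * b) > 0"
    using assms by (auto simp: cross_block_def)
  show "cross (b + z * c) (z * b + z * c) \<ge> 0"
    using cross_step(1)[of z 0 b "z * c"] z pos by simp
  show *: "cross (z * b + z * c) (z * (b + z * c)) > 0"
    using z pos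
    by (simp add: distrib_left[of z b "z * c"] cross_add_left cross_add_right cross_mult_both cross_mult_self
        add_pos_nonneg add_nonneg_pos zero_less_mult_iff)
  show "b + z * c \<noteq> 0"
    using * by (metis cross_zero_right mult_zero_right less_irrefl)
qed

text \<open>Blocks 1 to 5 belong to the last entries 3, 2, \<plusminus>1, -2, -3 at
  \<open>n = 4\<close>, with the common factor 2 dropped. In blocks 1 and 5 \<open>d\<close>
  vanishes at \<open>q = 1\<close>, where the two quadratics share the zero -1.\<close>

lemma cross_block_1:
  assumes q: "q > 0" and z: "Im z > 0"
  shows "cross_block z (quad 1 (1 + q) q z) (quad (3 + 5 * q + q^2) (1 + 5 * q + 4 * q^2) (q^2) z)"
  by (rule cross_block_quad[where p = "2 + 3 * q + 2 * q^2 + q^3" and r = "3 * q + 4 * q^2 + q^3"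
    and u = "q + 4 * q^2 + 3 * q^3"
    and d = "2 * q * (1 + q)^3 * (1 - q)^2", OF z], algebra, algebra, algebra, algebra)
    (use q in \<open>auto intro!: add_pos_pos add_nonneg_nonneg mult_nonneg_nonneg\<close>)

lemma cross_block_2:
  assumes q: "q > 0" and z: "Im z > 0"
  shows "cross_block z (quad 1 (3 + 2 * q) (2 * q) z) (quad (1 + 4 * q + q^2) (1 + 4 * q + 4 * q^2) (q^2) z)"
  by (rule cross_block_quad[where p = "2 + 10 * q + 7 * q^2 + 2 * q^3" and r = "2 * q + 7 * q^2 + 2 * q^3"
    and u = "2 * q + 5 * q^2 + 6 * q^3"
    and d = "4 * q + 26 * q^2 + 48 * q^3 + 42 * q^4 + 24 * q^5 + 8 * q^6", OF z], algebra, algebra, algebra, algebra)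
    (use q in \<open>auto intro!: add_pos_pos add_nonneg_nonneg mult_nonneg_nonneg\<close>)

lemma cross_block_3:
  assumes q: "q > 0" and z: "Im z > 0"
  shows "cross_block z (quad 1 (4 + 3 * q) (1 + 3 * q) z) (quad (3 * q + q^2) (3 * q + 4 * q^2) (q^2) z)"
  by (rule cross_block_quad[where p = "9 * q + 9 * q^2 + 3 * q^3" and r = "3 * q + 9 * q^2 + 3 * q^3"
    and u = "3 * q + 9 * q^2 + 9 * q^3"
    and d = "18 * q^2 + 54 * q^3 + 72 * q^4 + 54 * q^5 + 18 * q^6", OF z], algebra, algebra, algebra, algebra)
    (use q in \<open>auto intro!: add_pos_pos add_nonneg_nonneg mult_nonneg_nonneg\<close>)

lemma cross_block_4:
  assumes q: "q > 0" and z: "Im z > 0"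
  shows "cross_block z (quad 1 (4 + 4 * q + q^2) (1 + 4 * q + q^2) z) (quad (2 * q) (2 * q + 3 * q^2) (q^2) z)"
  by (rule cross_block_quad[where p = "6 * q + 5 * q^2 + 2 * q^3" and r = "2 * q + 7 * q^2 + 2 * q^3"
    and u = "2 * q + 7 * q^2 + 10 * q^3 + 2 * q^4"
    and d = "8 * q^2 + 24 * q^3 + 42 * q^4 + 48 * q^5 + 26 * q^6 + 4 * q^7", OF z], algebra, algebra, algebra, algebra)
    (use q in \<open>auto intro!: add_pos_pos add_nonneg_nonneg mult_nonneg_nonneg\<close>)

lemma cross_block_5:
  assumes q: "q > 0" and z: "Im z > 0"
  shows "cross_block z (quad 1 (4 + 5 * q + q^2) (1 + 5 * q + 3 * q^2) z) (quad q (q + q^2) (q^2) z)"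
  by (rule cross_block_quad[where p = "3 * q + 4 * q^2 + q^3" and r = "q + 4 * q^2 + 3 * q^3"
    and u = "q + 2 * q^2 + 3 * q^3 + 2 * q^4"
    and d = "2 * q^2 * (1 + q)^3 * (1 - q)^2", OF z], algebra, algebra, algebra, algebra)
    (use q in \<open>auto intro!: add_pos_pos add_nonneg_nonneg mult_nonneg_nonneg\<close>)

text \<open>The four \<open>cross_next\<close> lemmas compare adjacent non-extreme members at
  \<open>n = 4\<close>, stripped of the factor \<open>z\<close> and of positive constants.\<close>

lemma cross_next_1:
  assumes q: "q > 0" and z: "Im z > 0"
  shows "cross (quad (4 + 5 * q + q^2) (2 + 6 * q + 4 * q^2) (q + q^2) z) (quad (2 + 4 * q + q^2) (4 + 6 * q + 4 * q^2) (2 * q + q^2) z) > 0"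
  by (rule cross_quad_pos'[where p = "12 + 24 * q + 16 * q^2 + 4 * q^3" and r = "6 * q + 8 * q^2 + 2 * q^3"
    and u = "4 * q^2 + 4 * q^3"
    and d = "12 * q^2 + 48 * q^3 + 72 * q^4 + 48 * q^5 + 12 * q^6", OF z], algebra, algebra, algebra, algebra)
    (use q in \<open>auto intro!: add_pos_pos add_nonneg_nonneg mult_nonneg_nonneg\<close>)

lemma cross_next_2:
  assumes q: "q > 0" and z: "Im z > 0"
  shows "cross (quad (2 + 4 * q + q^2) (4 + 6 * q + 4 * q^2) (2 * q + q^2) z) (quad (1 + 3 * q + q^2) (4 + 6 * q + 4 * q^2) (1 + 3 * q + q^2) z) > 0"
  by (rule cross_quad_pos'[where p = "4 + 10 * q + 10 * q^2 + 4 * q^3" and r = "2 + 8 * q + 8 * q^2 + 2 * q^3"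
    and u = "4 + 10 * q + 10 * q^2 + 4 * q^3"
    and d = "12 + 48 * q + 84 * q^2 + 96 * q^3 + 84 * q^4 + 48 * q^5 + 12 * q^6", OF z], algebra, algebra, algebra, algebra)
    (use q in \<open>auto intro!: add_pos_pos add_nonneg_nonneg mult_nonneg_nonneg\<close>)

lemma cross_next_3:
  assumes q: "q > 0" and z: "Im z > 0"
  shows "cross (quad (1 + 3 * q + q^2) (4 + 6 * q + 4 * q^2) (1 + 3 * q + q^2) z) (quad (1 + 2 * q) (4 + 6 * q + 4 * q^2) (1 + 4 * q + 2 * q^2) z) > 0"
  by (rule cross_quad_pos'[where p = "4 * q + 10 * q^2 + 10 * q^3 + 4 * q^4" and r = "2 * q + 8 * q^2 + 8 * q^3 + 2 * q^4"
    and u = "4 * q + 10 * q^2 + 10 * q^3 + 4 * q^4"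
    and d = "12 * q^2 + 48 * q^3 + 84 * q^4 + 96 * q^5 + 84 * q^6 + 48 * q^7 + 12 * q^8", OF z], algebra, algebra, algebra, algebra)
    (use q in \<open>auto intro!: add_pos_pos add_nonneg_nonneg mult_nonneg_nonneg\<close>)

lemma cross_next_4:
  assumes q: "q > 0" and z: "Im z > 0"
  shows "cross (quad (1 + 2 * q) (4 + 6 * q + 4 * q^2) (1 + 4 * q + 2 * q^2) z) (quad (1 + q) (4 + 6 * q + 2 * q^2) (1 + 5 * q + 4 * q^2) z) > 0"
  by (rule cross_quad_pos'[where p = "4 * q + 4 * q^2" and r = "2 * q + 8 * q^2 + 6 * q^3"
    and u = "4 * q + 16 * q^2 + 24 * q^3 + 12 * q^4"
    and d = "12 * q^2 + 48 * q^3 + 72 * q^4 + 48 * q^5 + 12 * q^6", OF z], algebra, algebra, algebra, algebra)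
    (use q in \<open>auto intro!: add_pos_pos add_nonneg_nonneg mult_nonneg_nonneg\<close>)

section \<open>Explicit refined sums for n = 2, 3, 4\<close>

text \<open>The descent at 0 involves \<open>\<sigma> 2\<close>, so the recurrence starts from level
  2, and level 2 is enumerated from these two elements.\<close>

lemma signed_perms_1: "signed_perms 1 = {id, coset_rep 1 (-1)}"
proof
  have "id \<in> signed_perms 1"
    by (simp add: signed_perms_iff permutes_id)
  moreover have "coset_rep 1 (-1) \<in> signed_perms 1"
    by (rule coset_rep_signed_perms) (simp add: letters_iff)
  ultimately show "{id, coset_rep 1 (-1)} \<subseteq> signed_perms 1"
    by simp
  show "signed_perms 1 \<subseteq> {id, coset_rep 1 (-1)}"
  proof
    fix \<sigma>
    assume \<sigma>: "\<sigma> \<in> signed_perms 1"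
    have one: "\<sigma> 1 = 1 \<or> \<sigma> 1 = -1"
      using signed_perms_letters[OF \<sigma>, of 1] by (auto simp: letters_iff)
    have minus_one: "\<sigma> (-1) = - \<sigma> 1"
      using \<sigma> by (simp add: signed_perms_iff)
    have other: "\<sigma> i = i" if "i \<noteq> 1" "i \<noteq> -1" for i
      using \<sigma> that permutes_not_in[of \<sigma> "letters 1" i] by (cases "i = 0") (auto simp: signed_perms_iff letters_iff)
    have "\<sigma> = id" if "\<sigma> 1 = 1"
    proof
      show "\<sigma> i = id i" for i
        using that minus_one other[of i] by (cases "i = 1 \<or> i = -1") auto
    qed
    moreover have "\<sigma> = coset_rep 1 (-1)" if "\<sigma> 1 = -1"
    proof
      show "\<sigma> i = coset_rep 1 (-1) i" for i
        using that minus_one other[of i] by (cases "i = 1 \<or> i = -1") (auto simp: coset_rep_def)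
    qed
    ultimately show "\<sigma> \<in> {id, coset_rep 1 (-1)}"
      using one by auto
  qed
qed

lemma weight_2:
  "weight 2 q z \<sigma> = of_real (if \<sigma> 2 < 0 then q else 1)
     * z ^ ((if \<sigma> 1 + \<sigma> 2 < 0 then 1 else 0) + (if \<sigma> 1 > \<sigma> 2 then 1 else 0))"
proof -
  have "{i \<in> {2..int 2}. \<sigma> i < 0} = (if \<sigma> 2 < 0 then {2} else {})"
    by auto
  then have "neg_D 2 \<sigma> = (if \<sigma> 2 < 0 then 1 else 0)"
    by (simp add: neg_D_def)
  moreover have "{2..int 2 - 1} = ({} :: int set)"
    by auto
  ultimately show ?thesis
    unfolding weight_def by (subst des_D_split) auto
qed

text \<open>Each last entry leaves two permutations, which differ in the sign of
  \<open>\<sigma> 1\<close> and have equal weight; hence the factor 2.\<close>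

lemma last_sum_2:
  "last_sum q z 2 2 = 2" "last_sum q z 2 1 = 2 * z" "last_sum q z 2 (-1) = 2 * (of_real q * z)"
  "last_sum q z 2 (-2) = 2 * (of_real q * z\<^sup>2)"
proof -
  have *: "last_sum q z 2 k = weight 2 q z (coset_rep 2 k) + weight 2 q z (coset_rep 2 k \<circ> coset_rep 1 (-1))"
    if "k \<in> letters 2" for k
  proof -
    have "id \<noteq> coset_rep 1 (-1)"
      by (auto simp: fun_eq_iff coset_rep_def intro!: exI[of _ 1])
    moreover have "last_sum q z 2 k = (\<Sum>\<tau>\<in>signed_perms 1. weight 2 q z (coset_rep 2 k \<circ> \<tau>))"
      using sum.reindex_bij_betw[OF bij_betw_coset_rep[of k 1], of "weight 2 q z"] that
      by (simp add: last_sum_def numeral_2_eq_2)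
    ultimately show ?thesis
      by (simp add: signed_perms_1 del: One_nat_def)
  qed
  show "last_sum q z 2 2 = 2" "last_sum q z 2 1 = 2 * z" "last_sum q z 2 (-1) = 2 * (of_real q * z)"
    "last_sum q z 2 (-2) = 2 * (of_real q * z\<^sup>2)"
    by (subst *; simp add: letters_iff weight_2 coset_rep_def power2_eq_square)+
qed

lemma letters_2: "letters 2 = {-2, -1, 1, 2}"
  by (auto simp: letters_iff)

lemma letters_3: "letters 3 = {-3, -2, -1, 1, 2, 3}"
  by (auto simp: letters_iff)

lemma last_sum_3:
  fixes q :: real and z :: complex
  defines "r \<equiv> of_real q"
  shows "last_sum q z 3 3 = 2 * ((1 + z) * (1 + r * z))"
    and "last_sum q z 3 2 = 2 * (z * (2 + r + r * z))"
    and "last_sum q z 3 1 = 2 * ((1 + r) * z * (1 + z))"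
    and "last_sum q z 3 (-1) = 2 * (r * (1 + r) * z * (1 + z))"
    and "last_sum q z 3 (-2) = 2 * (r * z * (1 + (1 + 2 * r) * z))"
    and "last_sum q z 3 (-3) = 2 * (r * z * (1 + z) * (1 + r * z))"
proof -
  have *: "last_sum q z 3 k = (if k < 0 then r else 1)
      * (\<Sum>j\<in>letters 2. (if descends k j then z else 1) * last_sum q z 2 j)" if "k \<in> letters 3" for k
    using last_sum_Suc[of 2 k q z] that by (simp add: r_def)
  show "last_sum q z 3 3 = 2 * ((1 + z) * (1 + r * z))"
    and "last_sum q z 3 2 = 2 * (z * (2 + r + r * z))"
    and "last_sum q z 3 1 = 2 * ((1 + r) * z * (1 + z))"
    and "last_sum q z 3 (-1) = 2 * (r * (1 + r) * z * (1 + z))"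
    and "last_sum q z 3 (-2) = 2 * (r * z * (1 + (1 + 2 * r) * z))"
    and "last_sum q z 3 (-3) = 2 * (r * z * (1 + z) * (1 + r * z))"
    by (subst *; simp add: letters_iff letters_2 descends_def last_sum_2 flip: r_def;
        simp add: algebra_simps power2_eq_square)+
qed

text \<open>Half of the full sum at level 3, written in the form to which
  \<open>cross_block_1\<close> applies.\<close>

definition top_sum :: "real \<Rightarrow> complex \<Rightarrow> complex" where
  "top_sum q z = quad 1 (1 + q) q z + z * quad (3 + 5 * q + q^2) (1 + 5 * q + 4 * q^2) (q^2) z"

lemma last_sum_4:
  shows "last_sum q z 4 4 = 2 * top_sum q z"
    and "last_sum q z 4 3 = 2 * (z * quad (4 + 5 * q + q^2) (2 + 6 * q + 4 * q^2) (q + q^2) z)"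
    and "last_sum q z 4 2 = 2 * (z * quad (2 + 4 * q + q^2) (4 + 6 * q + 4 * q^2) (2 * q + q^2) z)"
    and "last_sum q z 4 1 = 2 * (z * quad (1 + 3 * q + q^2) (4 + 6 * q + 4 * q^2) (1 + 3 * q + q^2) z)"
    and "last_sum q z 4 (-1) = 2 * of_real q * (z * quad (1 + 3 * q + q^2) (4 + 6 * q + 4 * q^2) (1 + 3 * q + q^2) z)"
    and "last_sum q z 4 (-2) = 2 * of_real q * (z * quad (1 + 2 * q) (4 + 6 * q + 4 * q^2) (1 + 4 * q + 2 * q^2) z)"
    and "last_sum q z 4 (-3) = 2 * of_real q * (z * quad (1 + q) (4 + 6 * q + 2 * q^2) (1 + 5 * q + 4 * q^2) z)"
    and "last_sum q z 4 (-4) = 2 * of_real q * (z * top_sum q z)"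
proof -
  have *: "last_sum q z 4 k = (if k < 0 then of_real q else 1)
      * (\<Sum>j\<in>letters 3. (if descends k j then z else 1) * last_sum q z 3 j)" if "k \<in> letters 4" for k
    using last_sum_Suc[of 3 k q z] that by simp
  show "last_sum q z 4 4 = 2 * top_sum q z"
    and "last_sum q z 4 3 = 2 * (z * quad (4 + 5 * q + q^2) (2 + 6 * q + 4 * q^2) (q + q^2) z)"
    and "last_sum q z 4 2 = 2 * (z * quad (2 + 4 * q + q^2) (4 + 6 * q + 4 * q^2) (2 * q + q^2) z)"
    and "last_sum q z 4 1 = 2 * (z * quad (1 + 3 * q + q^2) (4 + 6 * q + 4 * q^2) (1 + 3 * q + q^2) z)"
    and "last_sum q z 4 (-1) = 2 * of_real q * (z * quad (1 + 3 * q + q^2) (4 + 6 * q + 4 * q^2) (1 + 3 * q + q^2) z)"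
    and "last_sum q z 4 (-2) = 2 * of_real q * (z * quad (1 + 2 * q) (4 + 6 * q + 4 * q^2) (1 + 4 * q + 2 * q^2) z)"
    and "last_sum q z 4 (-3) = 2 * of_real q * (z * quad (1 + q) (4 + 6 * q + 2 * q^2) (1 + 5 * q + 4 * q^2) z)"
    and "last_sum q z 4 (-4) = 2 * of_real q * (z * top_sum q z)"
    by (subst *; simp add: letters_iff letters_3 descends_def last_sum_3;
        simp add: top_sum_def quad_def algebra_simps power2_eq_square)+
qed

text \<open>The families for \<open>n = 2\<close> and \<open>n = 3\<close> are not interlacing (e.g. \<open>1\<close> and \<open>q * z\<^sup>2\<close> for
  \<open>n = 2\<close>), so the induction can only start here.\<close>

lemma interlacing_last_sum_4:
  assumes q: "q > 0" and z: "Im z > 0"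
  shows "interlacing z (letters 4) (last_sum q z 4)"
proof -
  define S where "S = top_sum q z"
  \<comment> \<open>Six functions suffice: entries 1 and -1 differ by the scalar \<open>q\<close>,
    and entry -4 gives \<open>z * S\<close> up to a scalar.\<close>
  define g where "g t = (if t = 0 then S
    else if t = 1 then z * quad (4 + 5 * q + q^2) (2 + 6 * q + 4 * q^2) (q + q^2) z
    else if t = 2 then z * quad (2 + 4 * q + q^2) (4 + 6 * q + 4 * q^2) (2 * q + q^2) z
    else if t = 3 then z * quad (1 + 3 * q + q^2) (4 + 6 * q + 4 * q^2) (1 + 3 * q + q^2) z
    else if t = 4 then z * quad (1 + 2 * q) (4 + 6 * q + 4 * q^2) (1 + 4 * q + 2 * q^2) z
    else z * quad (1 + q) (4 + 6 * q + 2 * q^2) (1 + 5 * q + 4 * q^2) z)" for t :: nat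
  \<comment> \<open>\<open>S\<close> is split anew for each of the five blocks; a factor
    \<open>z\<close> on the first part then produces \<open>g 1\<close> to
    \<open>g 5\<close>.\<close>
  have S1: "S = quad 1 (1 + q) q z + z * quad (3 + 5 * q + q^2) (1 + 5 * q + 4 * q^2) (q^2) z"
    by (simp add: S_def top_sum_def quad_def algebra_simps power2_eq_square)
  have g1: "g 1 = z * quad 1 (1 + q) q z + z * quad (3 + 5 * q + q^2) (1 + 5 * q + 4 * q^2) (q^2) z"
    by (simp add: g_def quad_def algebra_simps power2_eq_square)
  note block1 = cross_block_combine[OF z cross_block_1[OF q z], folded S1 g1]
  have S2: "S = quad 1 (3 + 2 * q) (2 * q) z + z * quad (1 + 4 * q + q^2) (1 + 4 * q + 4 * q^2) (q^2) z"
    by (simp add: S_def top_sum_def quad_def algebra_simps power2_eq_square)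
  have g2: "g 2 = z * quad 1 (3 + 2 * q) (2 * q) z + z * quad (1 + 4 * q + q^2) (1 + 4 * q + 4 * q^2) (q^2) z"
    by (simp add: g_def quad_def algebra_simps power2_eq_square)
  note block2 = cross_block_combine[OF z cross_block_2[OF q z], folded S2 g2]
  have S3: "S = quad 1 (4 + 3 * q) (1 + 3 * q) z + z * quad (3 * q + q^2) (3 * q + 4 * q^2) (q^2) z"
    by (simp add: S_def top_sum_def quad_def algebra_simps power2_eq_square)
  have g3: "g 3 = z * quad 1 (4 + 3 * q) (1 + 3 * q) z + z * quad (3 * q + q^2) (3 * q + 4 * q^2) (q^2) z"
    by (simp add: g_def quad_def algebra_simps power2_eq_square)
  note block3 = cross_block_combine[OF z cross_block_3[OF q z], folded S3 g3]
  have S4: "S = quad 1 (4 + 4 * q + q^2) (1 + 4 * q + q^2) z + z * quad (2 * q) (2 * q + 3 * q^2) (q^2) z"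
    by (simp add: S_def top_sum_def quad_def algebra_simps power2_eq_square)
  have g4: "g 4 = z * quad 1 (4 + 4 * q + q^2) (1 + 4 * q + q^2) z + z * quad (2 * q) (2 * q + 3 * q^2) (q^2) z"
    by (simp add: g_def quad_def algebra_simps power2_eq_square)
  note block4 = cross_block_combine[OF z cross_block_4[OF q z], folded S4 g4]
  have S5: "S = quad 1 (4 + 5 * q + q^2) (1 + 5 * q + 3 * q^2) z + z * quad q (q + q^2) (q^2) z"
    by (simp add: S_def top_sum_def quad_def algebra_simps power2_eq_square)
  have g5: "g 5 = z * quad 1 (4 + 5 * q + q^2) (1 + 5 * q + 3 * q^2) z + z * quad q (q + q^2) (q^2) z"
    by (simp add: g_def quad_def algebra_simps power2_eq_square)
  note block5 = cross_block_combine[OF z cross_block_5[OF q z], folded S5 g5]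
  have cases5: "t = 0 \<or> t = 1 \<or> t = 2 \<or> t = 3 \<or> t = 4 \<or> t = 5" if "t \<le> 5" for t :: nat
    using that by arith
  have g0: "g 0 = S"
    by (simp add: g_def)
  have nz: "g 0 \<noteq> 0"
    unfolding g0 by (rule block1(3))
  have lo: "cross (g 0) (g t) \<ge> 0" and hi: "cross (g t) (z * g 0) > 0" if "t \<le> 5" for t
    using cases5[OF that] block1 block2 block3 block4 block5 z
    by (auto simp: g0 cross_mult_self)
  have nxt: "cross (g t) (g (Suc t)) \<ge> 0" if "t < 5" for t
  proof -
    have "t = 0 \<or> t = 1 \<or> t = 2 \<or> t = 3 \<or> t = 4"
      using that by arith
    moreover have "cross (g 1) (g 2) \<ge> 0" "cross (g 2) (g 3) \<ge> 0" "cross (g 3) (g 4) \<ge> 0" "cross (g 4) (g 5) \<ge> 0"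
      using cross_next_1[OF q z] cross_next_2[OF q z] cross_next_3[OF q z] cross_next_4[OF q z]
      by (simp_all add: g_def cross_mult_both)
    ultimately show ?thesis
      using lo[of 1] by (auto simp: numeral_eq_Suc)
  qed
  note chain = cross_chain[OF z nz lo hi nxt]
  define w where "w k = (if k < 0 then 2 * q else 2)" for k :: int
  \<comment> \<open>Entries 4, 3, 2, 1 have positions 0 to 3, and -1, -2, -3 have positions 3 to
    5.\<close>
  define ix where "ix k = nat (if k > 0 then 4 - k else 2 - k)" for k :: int
  have w: "w k \<ge> 0" for k
    using q by (simp add: w_def)
  have E: "last_sum q z 4 k = of_real (w k) * g (ix k)" if "k \<in> letters 4" "k \<noteq> -4" for k
  proof -
    have "k = 4 \<or> k = 3 \<or> k = 2 \<or> k = 1 \<or> k = -1 \<or> k = -2 \<or> k = -3"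
      using that by (auto simp: letters_iff)
    then show ?thesis
      by (elim disjE; hypsubst) (simp_all add: last_sum_4 w_def ix_def g_def S_def)
  qed
  have E4: "last_sum q z 4 (-4) = of_real (w (-4)) * (z * g 0)"
    by (simp add: last_sum_4 w_def g0 S_def)
  show ?thesis
    unfolding interlacing_def
  proof (intro ballI impI)
    fix i j
    assume ij: "i \<in> letters 4" "j \<in> letters 4" "i < j"
    have j: "j \<noteq> -4" "ix j \<le> 5"
      using ij by (auto simp: letters_iff ix_def)
    show "cross (last_sum q z 4 j) (last_sum q z 4 i) \<ge> 0 \<and> cross (last_sum q z 4 i) (z * last_sum q z 4 j) \<ge> 0"
    proof (cases "i = -4")
      case True
      \<comment> \<open>Comparison with the last member \<open>z * g 0\<close> is exactly
        \<open>hi\<close> and, after cancelling \<open>z\<close>, \<open>lo\<close>.\<close>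
      have "cross (g (ix j)) (z * g 0) \<ge> 0" "cross (z * g 0) (z * g (ix j)) \<ge> 0"
        using lo[OF j(2)] hi[OF j(2)] by (simp_all add: cross_mult_both)
      then show ?thesis
        unfolding True E4 E[OF ij(2) j(1)] by (intro conjI cross_weights_nonneg cross_weights_nonneg' w)
    next
      case False
      have le: "ix j \<le> ix i" "ix i \<le> 5"
        using ij False by (auto simp: letters_iff ix_def)
      have "cross (g (ix j)) (g (ix i)) \<ge> 0" "cross (g (ix i)) (z * g (ix j)) \<ge> 0"
        using chain[OF _ _ _ le] by auto
      then show ?thesis
        unfolding E[OF ij(1) False] E[OF ij(2) j(1)]
        by (intro conjI cross_weights_nonneg cross_weights_nonneg' w)
    qed
  qed
qed

section \<open>Absence of zeros off the real axis\<close>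

lemma sum_last_sum_nonzero:
  assumes q: "q > 0" and z: "Im z > 0" and "n \<ge> 2"
  shows "(\<Sum>k\<in>letters n. last_sum q z n k) \<noteq> 0"
proof -
  have nz: "1 + of_real r * z \<noteq> 0" if "r > 0" for r
    using that z by (auto simp: complex_eq_iff)
  have base2: "(\<Sum>k\<in>letters 2. last_sum q z 2 k) \<noteq> 0"
  proof -
    have "(\<Sum>k\<in>letters 2. last_sum q z 2 k) = 2 * ((1 + of_real 1 * z) * (1 + of_real q * z))"
      by (simp add: letters_2 last_sum_2 algebra_simps power2_eq_square)
    then show ?thesis
      using nz[of 1] nz[OF q] by simp
  qed
  have base3: "(\<Sum>k\<in>letters 3. last_sum q z 3 k) \<noteq> 0"
  proof -
    \<comment> \<open>The full sum at level 3 reappears as the first member at level 4, which block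
      1 shows to be nonzero.\<close>
    have "last_sum q z 4 4 \<noteq> 0"
      using cross_block_combine(3)[OF z cross_block_1[OF q z]] unfolding last_sum_4(1) top_sum_def
      by (simp del: distrib_left_numeral)
    then show ?thesis
      using sum_last_sum_Suc(1)[of 3 q z] by simp
  qed
  have "interlacing z (letters n) (last_sum q z n) \<and> (\<Sum>k\<in>letters n. last_sum q z n k) \<noteq> 0" if "n \<ge> 4" for n
    using that
  proof (induction n rule: nat_induct_at_least)
    case base
    then show ?case
      using interlacing_last_sum_4[OF q z] sum_last_sum_Suc_nonzero[of 3 q z] base3 q z by simp
  next
    case (Suc n)
    then have "interlacing z (letters (Suc n)) (last_sum q z (Suc n))"
      using interlacing_last_sum_Suc[of n q z] q z by simp
    then show ?case
      using sum_last_sum_Suc_nonzero[of n q z] Suc q z by simp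
  qed
  moreover have "n = 2 \<or> n = 3 \<or> n \<ge> 4"
    using assms(3) by arith
  ultimately show ?thesis
    using base2 base3 by auto
qed

lemma poly_D_poly:
  "poly (map_poly complex_of_real (D_poly n q)) z = (\<Sum>\<sigma>\<in>even_signed_perms n. weight n q z \<sigma>)"
proof -
  have "map_poly complex_of_real (\<Sum>\<sigma>\<in>A. p \<sigma>) = (\<Sum>\<sigma>\<in>A. map_poly complex_of_real (p \<sigma>))"
    for A :: "(int \<Rightarrow> int) set" and p
    by (intro poly_eqI) (simp add: coeff_map_poly coeff_sum)
  then show ?thesis
    by (simp add: D_poly_def weight_def map_poly_monom poly_sum poly_monom)
qed

theorem theorem3p8:
  fixes n :: nat and q :: real
  assumes "n \<ge> 2" and "q > 0"
  shows "only_real_zeros (D_poly n q)"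
proof -
  have upper: "poly (map_poly complex_of_real (D_poly n q)) z \<noteq> 0" if "Im z > 0" for z
    using sum_last_sum_nonzero[OF assms(2) that assms(1)] sum_weight_even[OF assms(1), of q z]
      sum_weight_eq_sum_last_sum[of n "\<lambda>_. 1" q z] assms(1)
    by (auto simp: poly_D_poly)
  have "z \<in> \<real>" if "poly (map_poly complex_of_real (D_poly n q)) z = 0" for z
  proof -
    \<comment> \<open>The coefficients are real, so conjugation carries the lower half plane to the
      upper one.\<close>
    have "weight n q (cnj z) \<sigma> = cnj (weight n q z \<sigma>)" for \<sigma>
      by (simp add: weight_def)
    then have "poly (map_poly complex_of_real (D_poly n q)) (cnj z) = 0"
      using arg_cong[OF that, of cnj] by (simp add: poly_D_poly)
    then have "\<not> Im z > 0" "\<not> Im (cnj z) > 0"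
      using upper that by blast+
    then show ?thesis
      by (simp add: complex_is_Real_iff)
  qed
  then show ?thesis
    by (simp add: only_real_zeros_def)
qed

end
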